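(* Fix a group $g$ and an incumbent $(\bar v,\bar z)$ with realized coalition $c(g)=\{i\in N:\bar z_{ig}=1\}$, and assume the player variables are bounded above by (finite) $u$. Then the separation MIP given in the context and the separation problem $$\max_{s\subseteq c(g)}\Bigl\{V(s)-\sum_{i\in s}\bar v_i\Bigr\}$$ have the same optimal value, and every optimal $\sigma^*$ of the separation MIP yields a maximizer $s^*=\{i:\sigma^*_i=1\}$ of the separation problem. Hence the optimal value is nonpositive exactly when no subset of $c(g)$ violates stability at $\bar v$ (i.e. when $\sum_{i\in s}\bar v_i\ge V(s)$ for all $s\subseteq c(g)$).
   Context: **Game.** $N$ is a finite player set, $R$ a finite item set, $I_j\subseteq N$ the set of players for whom item $j$ is available, $R_i=\{j\in R:i\in I_j\}$. Data: profits $p^i_j\ge0$, weights $a_j>0$, budgets $b^i$, capacities $u^i_j\ge 0$, private constraints $B^ix^i\le d^i$, and a pooling parameter $\alpha\in(0,1]$. For a coalition $c\subseteq N$ let $I^c_j=I_j\cap c$, $R^c=\{j:I^c_j\ne\emptyset\}$, $R^c_{\mathrm{ind}}=\{j\in R^c:|I^c_j|=1\}$, $R^c_{\mathrm{com}}=\{j\in R^c:|I^c_j|\ge2\}$. With variables $x^i=(x^i_j)_{j\in R_i}$ for $i\in c$ and $y^c_j$ for $j\in R^c_{\mathrm{com}}$, $V(c)$ is the maximum of $\sum_{j\in R^c}\sum_{i\in I^c_j}p^i_jx^i_j$ subject to: $\sum_{j\in R^c_{\mathrm{com}}}a_jy^c_j+\sum_{j\in R^c_{\mathrm{ind}}}\sum_{i\in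 I^c_j}a_jx^i_j\le\sum_{i\in c}b^i$; $y^c_j=\sum_{i\in I^c_j}x^i_j$ for $j\in R^c_{\mathrm{com}}$; $B^ix^i\le d^i$ for $i\in c$; $0\le x^i_j\le u^i_j$; $0\le y^c_j\le\alpha\sum_{i\in I^c_j}u^i_j$ and $y^c_j\in\mathbb Z_+$ for $j\in R^c_{\mathrm{com}}$; $x^i_j\in\mathbb Z_+$ for $j\in R^c_{\mathrm{ind}}$ (the $x^i_j$ with $j\in R^c_{\mathrm{com}}$ are continuous). $V(\emptyset)=0$. Standing assumptions: every such program is feasible and bounded, the zero plan is feasible for every program, and the private constraints do not tie a member's common items to its other decisions. **Incumbent.** $\bar v\in\mathbb R^N$ is a payoff vector and $\bar z_{ig}\in\{0,1\}$ assigns players to groups $g\in G:=N$. **Separation MIP** (write $c=c(g)$). Variables $\sigma_i\in\{0,1\}$ ($i\in c$), $x^i_j$ ($i\in c$, $j\in R_i$), $y_j$ ($j\in R^c_{\mathrm{com}}$), and, if $\alpha<1$, $\kappa_j\in\{0,1\}$ ($j\in R^c_{\mathrm{com}}$). Maximize $\sum_{i\in c}\sum_{j\in R_i}p^i_jx^i_j-\sum_{i\in c}\bar v_i\sigma_i$ subject to $\sum_{j\in R^c_{\mathrm{ind}}}\sum_{i\in I_j\cap c}a_jx^i_j+\sum_{j\in R^c_{\mathrm{com}}}a_jy_j\le\sum_{i\in c}b^i\sigma_i$; $y_j=\sum_{i\in I_j\cap c}x^i_j$ for $j\in R^c_{\mathrm{com}}$; $B^ix^i\le d^i\sigma_i$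 for $i\in c$; $0\le x^i_j\le u^i_j\sigma_i$ for $i\in c$, $j\in R_i$; $y_j\le\sum_{i\in I_j\cap c}u^i_j\sigma_i$ for $j\in R^c_{\mathrm{com}}$; $x^i_j\in\mathbb Z_+$ for $i\in c$, $j\in R^c_{\mathrm{ind}}\cap R_i$; $y_j\in\mathbb Z_+$ for $j\in R^c_{\mathrm{com}}$; and, only if $\alpha<1$, for all $j\in R^c_{\mathrm{com}}$: $2\kappa_j\le\sum_{i\in I_j\cap c}\sigma_i\le(|I_j\cap c|-1)\kappa_j+1$ and $y_j\le\alpha\sum_{i\in I_j\cap c}u^i_j\sigma_i+M_j(1-\kappa_j)$, with $M_j=\sum_{i\in I_j\cap c}u^i_j$. *)

theory Defs
  imports Complex_Main
begin

text \<open>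
  All families are total functions. Entries with an index outside the stated range (for instance
  \<open>profit \<Gamma> i j\<close> with \<open>i \<notin> avail \<Gamma> j\<close>, or \<open>x i j\<close> with \<open>j \<notin> items_of \<Gamma> i\<close>) are junk that no
  constraint and no objective below reads. Capacities are real-valued, hence finite.
  The private constraint of player \<open>i\<close> is the system of \<open>priv_rows \<Gamma> i\<close> many inequalities
  with coefficient matrix \<open>priv_mat \<Gamma> i\<close> (row, item) and right-hand side \<open>priv_rhs \<Gamma> i\<close>.
\<close>

record ('i, 'r) game =
  players   :: "'i set"
  items     :: "'r set"
  avail     :: "'r \<Rightarrow> 'i set"
  profit    :: "'i \<Rightarrow> 'r \<Rightarrow> real"
  weight    :: "'r \<Rightarrow> real"
  budget    :: "'i \<Rightarrow> real"
  cap       :: "'i \<Rightarrow> 'r \<Rightarrow> real"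
  priv_rows :: "'i \<Rightarrow> nat"
  priv_mat  :: "'i \<Rightarrow> nat \<Rightarrow> 'r \<Rightarrow> real"
  priv_rhs  :: "'i \<Rightarrow> nat \<Rightarrow> real"
  pool      :: real

definition items_of :: "('i, 'r) game \<Rightarrow> 'i \<Rightarrow> 'r set" where
  "items_of \<Gamma> i = {j \<in> items \<Gamma>. i \<in> avail \<Gamma> j}"

definition avail_in :: "('i, 'r) game \<Rightarrow> 'i set \<Rightarrow> 'r \<Rightarrow> 'i set" where
  "avail_in \<Gamma> c j = avail \<Gamma> j \<inter> c"

definition R_all :: "('i, 'r) game \<Rightarrow> 'i set \<Rightarrow> 'r set" where
  "R_all \<Gamma> c = {j \<in> items \<Gamma>. avail_in \<Gamma> c j \<noteq> {}}"

definition R_ind :: "('i, 'r) game \<Rightarrow> 'i set \<Rightarrow> 'r set" where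
  "R_ind \<Gamma> c = {j \<in> R_all \<Gamma> c. card (avail_in \<Gamma> c j) = 1}"

definition R_com :: "('i, 'r) game \<Rightarrow> 'i set \<Rightarrow> 'r set" where
  "R_com \<Gamma> c = {j \<in> R_all \<Gamma> c. card (avail_in \<Gamma> c j) \<ge> 2}"

definition priv_lhs :: "('i, 'r) game \<Rightarrow> 'i \<Rightarrow> ('r \<Rightarrow> real) \<Rightarrow> nat \<Rightarrow> real" where
  "priv_lhs \<Gamma> i xi k = (\<Sum>j\<in>items_of \<Gamma> i. priv_mat \<Gamma> i k j * xi j)"

definition priv_ok :: "('i, 'r) game \<Rightarrow> 'i \<Rightarrow> ('r \<Rightarrow> real) \<Rightarrow> bool" where
  "priv_ok \<Gamma> i xi \<longleftrightarrow> (\<forall>k<priv_rows \<Gamma> i. priv_lhs \<Gamma> i xi k \<le> priv_rhs \<Gamma> i k)"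


subsection \<open>The coalition program\<close>

text \<open>The set \<open>\<nat>\<close> of reals plays the role of the nonnegative integers.\<close>

definition coal_feasible ::
  "('i, 'r) game \<Rightarrow> 'i set \<Rightarrow> ('i \<Rightarrow> 'r \<Rightarrow> real) \<Rightarrow> ('r \<Rightarrow> real) \<Rightarrow> bool" where
  "coal_feasible \<Gamma> c x y \<longleftrightarrow>
     (\<Sum>j\<in>R_com \<Gamma> c. weight \<Gamma> j * y j)
       + (\<Sum>j\<in>R_ind \<Gamma> c. \<Sum>i\<in>avail_in \<Gamma> c j. weight \<Gamma> j * x i j) \<le> (\<Sum>i\<in>c. budget \<Gamma> i)
   \<and> (\<forall>j\<in>R_com \<Gamma> c. y j = (\<Sum>i\<in>avail_in \<Gamma> c j. x i j))
   \<and> (\<forall>i\<in>c. priv_ok \<Gamma> i (x i))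
   \<and> (\<forall>i\<in>c. \<forall>j\<in>items_of \<Gamma> i. 0 \<le> x i j \<and> x i j \<le> cap \<Gamma> i j)
   \<and> (\<forall>j\<in>R_com \<Gamma> c. 0 \<le> y j \<and> y j \<le> pool \<Gamma> * (\<Sum>i\<in>avail_in \<Gamma> c j. cap \<Gamma> i j)
        \<and> y j \<in> \<nat>)
   \<and> (\<forall>j\<in>R_ind \<Gamma> c. \<forall>i\<in>avail_in \<Gamma> c j. x i j \<in> \<nat>)"

definition coal_objective :: "('i, 'r) game \<Rightarrow> 'i set \<Rightarrow> ('i \<Rightarrow> 'r \<Rightarrow> real) \<Rightarrow> real" where
  "coal_objective \<Gamma> c x = (\<Sum>j\<in>R_all \<Gamma> c. \<Sum>i\<in>avail_in \<Gamma> c j. profit \<Gamma> i j * x i j)"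

text \<open>
  \<open>GREATEST\<close> is the maximum of the set of objective values, an attained value; it is meaningful
  because finite capacities make the attainable values of a feasible program have a maximum.
\<close>

definition V :: "('i, 'r) game \<Rightarrow> 'i set \<Rightarrow> real" where
  "V \<Gamma> c = (if c = {} then 0
     else (GREATEST v. \<exists>x y. coal_feasible \<Gamma> c x y \<and> v = coal_objective \<Gamma> c x))"

text \<open>
  Assumption \<open>untied\<close> says that, for each coalition and each of its members, the privately feasible
  plans form a product over the common and the remaining items: the common part of one plan can be
  combined with the rest of another.
\<close>

locale pooling_game =
  fixes \<Gamma> :: "('i, 'r) game"
  assumes finite_players: "finite (players \<Gamma>)"
    and finite_items: "finite (items \<Gamma>)"
    and avail_subset: "j \<in> items \<Gamma> \<Longrightarrow> avail \<Gamma> j \<subseteq> players \<Gamma>"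
    and profit_nonneg: "j \<in> items \<Gamma> \<Longrightarrow> i \<in> avail \<Gamma> j \<Longrightarrow> 0 \<le> profit \<Gamma> i j"
    and weight_pos: "j \<in> items \<Gamma> \<Longrightarrow> 0 < weight \<Gamma> j"
    and cap_nonneg: "j \<in> items \<Gamma> \<Longrightarrow> i \<in> avail \<Gamma> j \<Longrightarrow> 0 \<le> cap \<Gamma> i j"
    and pool_pos: "0 < pool \<Gamma>"
    and pool_le_1: "pool \<Gamma> \<le> 1"
    and feasible: "c \<subseteq> players \<Gamma> \<Longrightarrow> \<exists>x y. coal_feasible \<Gamma> c x y"
    and bounded: "c \<subseteq> players \<Gamma> \<Longrightarrow>
      bdd_above {coal_objective \<Gamma> c x |x y. coal_feasible \<Gamma> c x y}"
    and zero_plan: "c \<subseteq> players \<Gamma> \<Longrightarrow> coal_feasible \<Gamma> c (\<lambda>_ _. 0) (\<lambda>_. 0)"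
    and untied: "c \<subseteq> players \<Gamma> \<Longrightarrow> i \<in> c \<Longrightarrow> priv_ok \<Gamma> i xi \<Longrightarrow> priv_ok \<Gamma> i xi' \<Longrightarrow>
      priv_ok \<Gamma> i (\<lambda>j. if j \<in> R_com \<Gamma> c then xi j else xi' j)"


subsection \<open>The separation problem\<close>

definition sep_gain :: "('i, 'r) game \<Rightarrow> ('i \<Rightarrow> real) \<Rightarrow> 'i set \<Rightarrow> real" where
  "sep_gain \<Gamma> vbar s = V \<Gamma> s - (\<Sum>i\<in>s. vbar i)"

definition sep_value :: "('i, 'r) game \<Rightarrow> ('i \<Rightarrow> real) \<Rightarrow> 'i set \<Rightarrow> real" where
  "sep_value \<Gamma> vbar c = Max (sep_gain \<Gamma> vbar ` Pow c)"


subsection \<open>The separation MIP\<close>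

definition bigM :: "('i, 'r) game \<Rightarrow> 'i set \<Rightarrow> 'r \<Rightarrow> real" where
  "bigM \<Gamma> c j = (\<Sum>i\<in>avail_in \<Gamma> c j. cap \<Gamma> i j)"

text \<open>When \<open>pool \<Gamma> = 1\<close> the argument \<open>\<kappa>\<close> is unconstrained and unused: it is not a variable then.\<close>

definition mip_feasible ::
  "('i, 'r) game \<Rightarrow> 'i set \<Rightarrow> ('i \<Rightarrow> real) \<Rightarrow> ('i \<Rightarrow> 'r \<Rightarrow> real) \<Rightarrow> ('r \<Rightarrow> real) \<Rightarrow> ('r \<Rightarrow> real) \<Rightarrow> bool"
where
  "mip_feasible \<Gamma> c \<sigma> x y \<kappa> \<longleftrightarrow>
     (\<forall>i\<in>c. \<sigma> i \<in> {0, 1})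
   \<and> (\<Sum>j\<in>R_ind \<Gamma> c. \<Sum>i\<in>avail_in \<Gamma> c j. weight \<Gamma> j * x i j)
       + (\<Sum>j\<in>R_com \<Gamma> c. weight \<Gamma> j * y j) \<le> (\<Sum>i\<in>c. budget \<Gamma> i * \<sigma> i)
   \<and> (\<forall>j\<in>R_com \<Gamma> c. y j = (\<Sum>i\<in>avail_in \<Gamma> c j. x i j))
   \<and> (\<forall>i\<in>c. \<forall>k<priv_rows \<Gamma> i. priv_lhs \<Gamma> i (x i) k \<le> priv_rhs \<Gamma> i k * \<sigma> i)
   \<and> (\<forall>i\<in>c. \<forall>j\<in>items_of \<Gamma> i. 0 \<le> x i j \<and> x i j \<le> cap \<Gamma> i j * \<sigma> i)
   \<and> (\<forall>j\<in>R_com \<Gamma> c. y j \<le> (\<Sum>i\<in>avail_in \<Gamma> c j. cap \<Gamma> i j * \<sigma> i))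
   \<and> (\<forall>i\<in>c. \<forall>j\<in>R_ind \<Gamma> c \<inter> items_of \<Gamma> i. x i j \<in> \<nat>)
   \<and> (\<forall>j\<in>R_com \<Gamma> c. y j \<in> \<nat>)
   \<and> (pool \<Gamma> < 1 \<longrightarrow> (\<forall>j\<in>R_com \<Gamma> c.
        \<kappa> j \<in> {0, 1}
      \<and> 2 * \<kappa> j \<le> (\<Sum>i\<in>avail_in \<Gamma> c j. \<sigma> i)
      \<and> (\<Sum>i\<in>avail_in \<Gamma> c j. \<sigma> i) \<le> (real (card (avail_in \<Gamma> c j)) - 1) * \<kappa> j + 1
      \<and> y j \<le> pool \<Gamma> * (\<Sum>i\<in>avail_in \<Gamma> c j. cap \<Gamma> i j * \<sigma> i) + bigM \<Gamma> c j * (1 - \<kappa> j)))"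

definition mip_objective ::
  "('i, 'r) game \<Rightarrow> ('i \<Rightarrow> real) \<Rightarrow> 'i set \<Rightarrow> ('i \<Rightarrow> real) \<Rightarrow> ('i \<Rightarrow> 'r \<Rightarrow> real) \<Rightarrow> real" where
  "mip_objective \<Gamma> vbar c \<sigma> x =
     (\<Sum>i\<in>c. \<Sum>j\<in>items_of \<Gamma> i. profit \<Gamma> i j * x i j) - (\<Sum>i\<in>c. vbar i * \<sigma> i)"

definition mip_optimal ::
  "('i, 'r) game \<Rightarrow> ('i \<Rightarrow> real) \<Rightarrow> 'i set \<Rightarrow>
   ('i \<Rightarrow> real) \<Rightarrow> ('i \<Rightarrow> 'r \<Rightarrow> real) \<Rightarrow> ('r \<Rightarrow> real) \<Rightarrow> ('r \<Rightarrow> real) \<Rightarrow> bool" where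
  "mip_optimal \<Gamma> vbar c \<sigma> x y \<kappa> \<longleftrightarrow>
     is_arg_max (\<lambda>(\<sigma>, x, y, \<kappa>). mip_objective \<Gamma> vbar c \<sigma> x)
       (\<lambda>(\<sigma>, x, y, \<kappa>). mip_feasible \<Gamma> c \<sigma> x y \<kappa>) (\<sigma>, x, y, \<kappa>)"

definition mip_value :: "('i, 'r) game \<Rightarrow> ('i \<Rightarrow> real) \<Rightarrow> 'i set \<Rightarrow> real" where
  "mip_value \<Gamma> vbar c =
     (GREATEST v. \<exists>\<sigma> x y \<kappa>. mip_feasible \<Gamma> c \<sigma> x y \<kappa> \<and> v = mip_objective \<Gamma> vbar c \<sigma> x)"

end

theory Submission
  imports Defs "HOL-Analysis.Function_Topology" "HOL-Analysis.Elementary_Normed_Spaces"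
begin

text \<open>
  Choosing \<open>\<sigma>\<close> in the separation MIP amounts to choosing the coalition \<open>s = {i \<in> c. \<sigma> i = 1}\<close>: the
  capacity constraints force the plans of the other players to vanish, and what remains of the MIP
  is the program of \<open>s\<close>. The point to check is an item that is common in \<open>c\<close>. If at least two of its
  players are in \<open>s\<close>, then \<open>\<kappa> = 1\<close> and the pooling bound of \<open>s\<close> is active; if only one is, then
  \<open>\<kappa> = 0\<close>, the big-M term disables the bound, and integrality of \<open>y\<close> is the integrality of the
  individual plan. The program of \<open>s\<close> attains its maximum by compactness.
\<close>

section \<open>Maximizers and compact products\<close>

lemma is_arg_max_linorder_iff:
  fixes f :: "'a \<Rightarrow> 'b::linorder"
  shows "is_arg_max f P x \<longleftrightarrow> P x \<and> (\<forall>y. P y \<longrightarrow> f y \<le> f x)"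
  by (auto simp: is_arg_max_def not_less)

text \<open>Tychonoff's theorem, carried from the product topology over to the type class topology
  on functions. It is applied once for each argument of a plan.\<close>

lemma compact_PiE_UNIV:
  fixes A :: "'a \<Rightarrow> 'b::topological_space set"
  assumes "\<And>i. compact (A i)"
  shows "compact (PiE UNIV A)"
proof -
  have "compactin (product_topology (\<lambda>i. euclidean) UNIV) (PiE UNIV A)"
    using assms by (simp add: compactin_PiE)
  then show ?thesis
    by (simp add: euclidean_product_topology)
qed

section \<open>Zero extension of plans, loads and objectives\<close>

text \<open>Plans are total functions, and entries that no constraint reads may be arbitrarily
  large. Zeroing them puts a feasible plan into a compact box; the same zero extension turns a plan
  of \<open>s\<close> into one that meets the MIP capacities of the players outside
  \<open>s\<close>.\<close>

definition restrict_plan :: "('i, 'r) game \<Rightarrow> 'i set \<Rightarrow> ('i \<Rightarrow> 'r \<Rightarrow> real) \<Rightarrow> 'i \<Rightarrow> 'r \<Rightarrow> real" where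
  "restrict_plan \<Gamma> s x i j = (if i \<in> s \<and> j \<in> items_of \<Gamma> i then x i j else 0)"

lemma priv_lhs_cong:
  "(\<And>j. j \<in> items_of \<Gamma> i \<Longrightarrow> xi j = xi' j) \<Longrightarrow> priv_lhs \<Gamma> i xi = priv_lhs \<Gamma> i xi'"
  by (simp add: priv_lhs_def fun_eq_iff)

lemma priv_lhs_zero:
  "(\<And>j. j \<in> items_of \<Gamma> i \<Longrightarrow> xi j = 0) \<Longrightarrow> priv_lhs \<Gamma> i xi k = 0"
  by (simp add: priv_lhs_def)

lemma mem_items_of: "j \<in> items \<Gamma> \<Longrightarrow> i \<in> avail_in \<Gamma> s j \<Longrightarrow> i \<in> s \<and> j \<in> items_of \<Gamma> i"
  by (simp add: items_of_def avail_in_def)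

lemma R_com_in_items: "j \<in> R_com \<Gamma> s \<Longrightarrow> j \<in> items \<Gamma>"
  by (simp add: R_com_def R_all_def)

lemma R_ind_in_items: "j \<in> R_ind \<Gamma> s \<Longrightarrow> j \<in> items \<Gamma>"
  by (simp add: R_ind_def R_all_def)

lemma avail_in_mono: "s \<subseteq> c \<Longrightarrow> avail_in \<Gamma> s j \<subseteq> avail_in \<Gamma> c j"
  by (auto simp: avail_in_def)

lemma sum_avail_in_restrict_plan:
  assumes "j \<in> items \<Gamma>" "s \<subseteq> c" "finite c"
  shows "(\<Sum>i\<in>avail_in \<Gamma> c j. restrict_plan \<Gamma> s x i j) = (\<Sum>i\<in>avail_in \<Gamma> s j. x i j)"
  using assms
  by (intro sum.mono_neutral_cong_right)
    (auto simp: avail_in_def restrict_plan_def items_of_def)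

text \<open>The following form of the load does not depend on which items are common.\<close>

lemma load_eq:
  assumes "finite (items \<Gamma>)" "finite s"
    and y: "\<And>j. j \<in> R_com \<Gamma> s \<Longrightarrow> y j = (\<Sum>i\<in>avail_in \<Gamma> s j. x i j)"
  shows "(\<Sum>j\<in>R_com \<Gamma> s. weight \<Gamma> j * y j)
      + (\<Sum>j\<in>R_ind \<Gamma> s. \<Sum>i\<in>avail_in \<Gamma> s j. weight \<Gamma> j * x i j)
    = (\<Sum>j\<in>items \<Gamma>. weight \<Gamma> j * (\<Sum>i\<in>avail_in \<Gamma> s j. x i j))"
proof -
  let ?L = "\<lambda>j. weight \<Gamma> j * (\<Sum>i\<in>avail_in \<Gamma> s j. x i j)"
  have fin: "finite (avail_in \<Gamma> s j)" for j
    using assms(2) by (simp add: avail_in_def)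
  have un: "R_all \<Gamma> s = R_com \<Gamma> s \<union> R_ind \<Gamma> s"
  proof -
    have "card (avail_in \<Gamma> s j) = 1 \<or> card (avail_in \<Gamma> s j) \<ge> 2" if "avail_in \<Gamma> s j \<noteq> {}" for j
      using that fin[of j] by (metis One_nat_def Suc_leI card_gt_0_iff le_neq_implies_less numeral_2_eq_2)
    then show ?thesis by (auto simp: R_com_def R_ind_def R_all_def)
  qed
  have disj: "R_com \<Gamma> s \<inter> R_ind \<Gamma> s = {}"
    by (auto simp: R_com_def R_ind_def)
  have finR: "finite (R_com \<Gamma> s)" "finite (R_ind \<Gamma> s)"
    using assms(1) by (auto simp: R_com_def R_ind_def R_all_def)
  \<comment> \<open>An item outside \<open>R_all\<close> has an empty inner sum. Summing over all
    items gives one index range for every coalition, which is what lets the loads of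
    \<open>s\<close> and \<open>c\<close> be compared.\<close>
  have "(\<Sum>j\<in>items \<Gamma>. ?L j) = (\<Sum>j\<in>R_all \<Gamma> s. ?L j)"
    using assms(1) by (intro sum.mono_neutral_right) (auto simp: R_all_def)
  also have "\<dots> = (\<Sum>j\<in>R_com \<Gamma> s. ?L j) + (\<Sum>j\<in>R_ind \<Gamma> s. ?L j)"
    unfolding un using finR disj by (rule sum.union_disjoint)
  finally show ?thesis
    by (simp add: y sum_distrib_left)
qed

lemma coal_objective_items:
  assumes "finite (items \<Gamma>)"
  shows "coal_objective \<Gamma> s x = (\<Sum>j\<in>items \<Gamma>. \<Sum>i\<in>avail_in \<Gamma> s j. profit \<Gamma> i j * x i j)"
  unfolding coal_objective_def using assms
  by (intro sum.mono_neutral_left) (auto simp: R_all_def)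

text \<open>Exchanging the two sums over the available pairs yields the player-first form in which
  the MIP states its objective.\<close>

lemma coal_objective_players:
  assumes "finite (items \<Gamma>)" "finite s"
  shows "coal_objective \<Gamma> s x = (\<Sum>i\<in>s. \<Sum>j\<in>items_of \<Gamma> i. profit \<Gamma> i j * x i j)"
proof -
  have *: "avail_in \<Gamma> s j = {i \<in> s. i \<in> avail \<Gamma> j}" for j
    by (auto simp: avail_in_def)
  show ?thesis
    unfolding coal_objective_items[OF assms(1)] items_of_def *
    using assms by (intro sum.swap_restrict)
qed

lemma coal_objective_empty: "coal_objective \<Gamma> {} x = 0"
  by (simp add: coal_objective_def avail_in_def)

lemma coal_objective_restrict_plan:
  "coal_objective \<Gamma> s (restrict_plan \<Gamma> s x) = coal_objective \<Gamma> s x"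
  unfolding coal_objective_def
  by (intro sum.cong refl) (auto simp: restrict_plan_def R_all_def dest: mem_items_of)

text \<open>Every entry that feasibility reads is kept, and \<open>y\<close> is forced by the plan
  at common items. Writing it as a function of the plan leaves a feasible set in \<open>x\<close>
  alone.\<close>

lemma coal_feasible_restrict_plan:
  assumes "coal_feasible \<Gamma> s x y"
  shows "coal_feasible \<Gamma> s (restrict_plan \<Gamma> s x)
    (\<lambda>j. \<Sum>i\<in>avail_in \<Gamma> s j. restrict_plan \<Gamma> s x i j)"
proof -
  have eq: "restrict_plan \<Gamma> s x i j = x i j" if "j \<in> items \<Gamma>" "i \<in> avail_in \<Gamma> s j" for i j
    using mem_items_of[OF that] by (simp add: restrict_plan_def)
  have eq': "restrict_plan \<Gamma> s x i j = x i j" if "i \<in> s" "j \<in> items_of \<Gamma> i" for i j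
    using that by (simp add: restrict_plan_def)
  have y: "(\<Sum>i\<in>avail_in \<Gamma> s j. x i j) = y j" if "j \<in> R_com \<Gamma> s" for j
    using assms that by (simp add: coal_feasible_def)
  have "priv_lhs \<Gamma> i (restrict_plan \<Gamma> s x i) = priv_lhs \<Gamma> i (x i)" if "i \<in> s" for i
    using that by (intro priv_lhs_cong) (simp add: restrict_plan_def)
  then show ?thesis
    using assms by (simp add: coal_feasible_def y eq eq' priv_ok_def R_ind_in_items R_com_in_items)
qed

section \<open>Attainment of the coalition value\<close>

context pooling_game
begin

text \<open>The extreme value theorem on the feasible plans inside the box: capacities make the box
  compact, all constraints are closed, and the zero plan shows nonemptiness.\<close>

lemma coal_max_exists:
  assumes s: "s \<subseteq> players \<Gamma>"
  shows "\<exists>x y. coal_feasible \<Gamma> s x y \<and>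
    (\<forall>x' y'. coal_feasible \<Gamma> s x' y' \<longrightarrow> coal_objective \<Gamma> s x' \<le> coal_objective \<Gamma> s x)"
proof -
  define Y where "Y x j = (\<Sum>i\<in>avail_in \<Gamma> s j. x i j)" for x :: "'i \<Rightarrow> 'r \<Rightarrow> real" and j
  define box where "box = PiE UNIV (\<lambda>i. PiE UNIV (\<lambda>j.
    if i \<in> s \<and> j \<in> items_of \<Gamma> i then {0..cap \<Gamma> i j} else {0}))"
  define F where "F = {x. coal_feasible \<Gamma> s x (Y x)}"
  have cont: "continuous_on UNIV (\<lambda>x :: 'i \<Rightarrow> 'r \<Rightarrow> real. x i j)" for i j
    using continuous_on_product_then_coordinatewise[OF
        continuous_on_product_then_coordinatewise[OF continuous_on_id]] .
  have contY: "continuous_on UNIV (\<lambda>x. Y x j)" for j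
    unfolding Y_def by (intro continuous_intros cont)
  have contP: "continuous_on UNIV (\<lambda>x. priv_lhs \<Gamma> i (x i) k)" for i k
    unfolding priv_lhs_def by (intro continuous_intros cont)
  \<comment> \<open>Integrality is a closed condition because \<open>\<nat>\<close> is closed in the
    reals.\<close>
  have nat: "closed {x. f x \<in> \<nat>}"
    if "continuous_on UNIV f" for f :: "('i \<Rightarrow> 'r \<Rightarrow> real) \<Rightarrow> real"
    using that closed_vimage[OF closed_Nats, of f] by (simp add: vimage_def)
  have "compact box"
    unfolding box_def by (intro compact_PiE_UNIV) simp
  \<comment> \<open>Unfolding leaves weak inequalities, equalities and integrality under
    implications. Their premises do not mention \<open>x\<close>, so they define open sets, as
    \<open>closed_Collect_imp\<close> demands.\<close>
  moreover have "closed F"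
    unfolding F_def coal_feasible_def priv_ok_def Ball_def
    by (intro closed_Collect_conj closed_Collect_all closed_Collect_imp closed_Collect_le
        closed_Collect_eq nat cont contY contP continuous_intros) simp_all
  ultimately have "compact (box \<inter> F)"
    by (rule compact_Int_closed)
  moreover have mem: "restrict_plan \<Gamma> s x \<in> box \<inter> F" if "coal_feasible \<Gamma> s x y" for x y
  proof
    show "restrict_plan \<Gamma> s x \<in> box"
      using that by (auto simp: box_def restrict_plan_def coal_feasible_def)
    show "restrict_plan \<Gamma> s x \<in> F"
      using coal_feasible_restrict_plan[OF that] by (simp add: F_def Y_def[abs_def])
  qed
  moreover from mem[OF zero_plan[OF s]] have "box \<inter> F \<noteq> {}" by blast
  moreover have "continuous_on (box \<inter> F) (coal_objective \<Gamma> s)"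
    unfolding coal_objective_def
    by (intro continuous_intros continuous_on_subset[OF cont subset_UNIV])
  ultimately obtain x where x: "x \<in> box \<inter> F"
    and max: "\<forall>x'\<in>box \<inter> F. coal_objective \<Gamma> s x' \<le> coal_objective \<Gamma> s x"
    using continuous_attains_sup by blast
  \<comment> \<open>A feasible plan may lie outside the box, but its restriction lies inside and has
    the same objective.\<close>
  have "coal_objective \<Gamma> s x' \<le> coal_objective \<Gamma> s x" if "coal_feasible \<Gamma> s x' y'" for x' y'
    using max mem[OF that] by (metis coal_objective_restrict_plan)
  then show ?thesis
    using x by (auto simp: F_def)
qed

lemma V_attained:
  assumes s: "s \<subseteq> players \<Gamma>"
  shows "\<exists>x y. coal_feasible \<Gamma> s x y \<and> coal_objective \<Gamma> s x = V \<Gamma> s"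
    and "coal_feasible \<Gamma> s x y \<Longrightarrow> coal_objective \<Gamma> s x \<le> V \<Gamma> s"
proof -
  obtain x0 y0 where 0: "coal_feasible \<Gamma> s x0 y0"
    and max: "\<And>x y. coal_feasible \<Gamma> s x y \<Longrightarrow> coal_objective \<Gamma> s x \<le> coal_objective \<Gamma> s x0"
    using coal_max_exists[OF s] by blast
  have V: "V \<Gamma> s = coal_objective \<Gamma> s x0"
  \<comment> \<open>The value 0 that \<open>V\<close> assigns to the empty coalition agrees with the
    objective of each of its plans.\<close>
  proof (cases "s = {}")
    case True
    then show ?thesis by (simp add: V_def coal_objective_empty)
  next
    case False
    then show ?thesis
      unfolding V_def using 0 max by (auto intro!: Greatest_equality)
  qed
  show "\<exists>x y. coal_feasible \<Gamma> s x y \<and> coal_objective \<Gamma> s x = V \<Gamma> s"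
    using 0 V by auto
  show "coal_feasible \<Gamma> s x y \<Longrightarrow> coal_objective \<Gamma> s x \<le> V \<Gamma> s"
    using max V by simp
qed

section \<open>From the separation MIP to the coalition program\<close>

lemma mip_feasible_imp_coal_feasible:
  assumes c: "c \<subseteq> players \<Gamma>" and mip: "mip_feasible \<Gamma> c \<sigma> x y \<kappa>"
  defines "s \<equiv> {i \<in> c. \<sigma> i = 1}"
  shows "coal_feasible \<Gamma> s x y"
    and "mip_objective \<Gamma> vbar c \<sigma> x = coal_objective \<Gamma> s x - (\<Sum>i\<in>s. vbar i)"
proof -
  have finc: "finite c" using c finite_players finite_subset by blast
  have sc: "s \<subseteq> c" by (auto simp: s_def)
  then have fins: "finite s" using finc finite_subset by blast
  have fina: "finite (avail_in \<Gamma> c j)" for j using finc by (simp add: avail_in_def)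
  note avs = avail_in_mono[OF sc]
  have \<sigma>: "\<sigma> i = (if i \<in> s then 1 else 0)" if "i \<in> c" for i
    using mip that by (auto simp: mip_feasible_def s_def)
  have box: "0 \<le> x i j" "x i j \<le> cap \<Gamma> i j * \<sigma> i" if "i \<in> c" "j \<in> items_of \<Gamma> i" for i j
    using mip that by (auto simp: mip_feasible_def)
  have x0: "x i j = 0" if "i \<in> c - s" "j \<in> items_of \<Gamma> i" for i j
    using box[of i j] that by (simp add: \<sigma>)
  have sum_x: "(\<Sum>i\<in>avail_in \<Gamma> c j. x i j) = (\<Sum>i\<in>avail_in \<Gamma> s j. x i j)" if "j \<in> items \<Gamma>" for j
    using fina avs sc that by (intro sum.mono_neutral_right) (auto simp: avail_in_def items_of_def intro!: x0)
  have sum_\<sigma>: "(\<Sum>i\<in>avail_in \<Gamma> c j. h i * \<sigma> i) = (\<Sum>i\<in>avail_in \<Gamma> s j. h i)" for h :: "'i \<Rightarrow> real" and j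
    using fina avs sc by (intro sum.mono_neutral_cong_right) (auto simp: avail_in_def \<sigma>)
  have sum_\<sigma>c: "(\<Sum>i\<in>c. h i * \<sigma> i) = (\<Sum>i\<in>s. h i)" for h :: "'i \<Rightarrow> real"
    using finc sc by (intro sum.mono_neutral_cong_right) (auto simp: \<sigma>)
  \<comment> \<open>Passing to a larger coalition can only make more items common, so the MIP
    constraints on \<open>y\<close> cover every common item of \<open>s\<close>.\<close>
  have com: "R_com \<Gamma> s \<subseteq> R_com \<Gamma> c"
  proof
    fix j assume "j \<in> R_com \<Gamma> s"
    then show "j \<in> R_com \<Gamma> c"
      using card_mono[OF fina[of j] avs[of \<Gamma> j]] avs[of \<Gamma> j] by (auto simp: R_com_def R_all_def)
  qed
  have yc: "y j = (\<Sum>i\<in>avail_in \<Gamma> c j. x i j)" if "j \<in> R_com \<Gamma> c" for j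
    using mip that by (simp add: mip_feasible_def)
  have ys: "y j = (\<Sum>i\<in>avail_in \<Gamma> s j. x i j)" if "j \<in> R_com \<Gamma> s" for j
    using yc sum_x R_com_in_items com that by (metis subsetD)
  \<comment> \<open>An item can be common in \<open>c\<close> and individual or absent in
    \<open>s\<close>. Rewriting both loads by \<open>load_eq\<close> avoids tracking such
    changes.\<close>
  have "(\<Sum>j\<in>R_com \<Gamma> s. weight \<Gamma> j * y j)
      + (\<Sum>j\<in>R_ind \<Gamma> s. \<Sum>i\<in>avail_in \<Gamma> s j. weight \<Gamma> j * x i j)
    = (\<Sum>j\<in>R_ind \<Gamma> c. \<Sum>i\<in>avail_in \<Gamma> c j. weight \<Gamma> j * x i j)
      + (\<Sum>j\<in>R_com \<Gamma> c. weight \<Gamma> j * y j)"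
    using load_eq[OF finite_items fins, of y x] load_eq[OF finite_items finc, of y x] ys yc
    by (simp add: sum_x)
  also have "\<dots> \<le> (\<Sum>i\<in>s. budget \<Gamma> i)"
    using mip unfolding mip_feasible_def sum_\<sigma>c by blast
  finally have budget: "(\<Sum>j\<in>R_com \<Gamma> s. weight \<Gamma> j * y j)
      + (\<Sum>j\<in>R_ind \<Gamma> s. \<Sum>i\<in>avail_in \<Gamma> s j. weight \<Gamma> j * x i j) \<le> (\<Sum>i\<in>s. budget \<Gamma> i)" .
  have pool: "0 \<le> y j \<and> y j \<le> pool \<Gamma> * (\<Sum>i\<in>avail_in \<Gamma> s j. cap \<Gamma> i j) \<and> y j \<in> \<nat>"
    if j: "j \<in> R_com \<Gamma> s" for j
  proof (intro conjI)
    have jc: "j \<in> R_com \<Gamma> c" using com j by blast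
    show nat: "y j \<in> \<nat>" using mip jc unfolding mip_feasible_def by blast
    then show "0 \<le> y j" by (auto elim: Nats_cases)
    show "y j \<le> pool \<Gamma> * (\<Sum>i\<in>avail_in \<Gamma> s j. cap \<Gamma> i j)"
    proof (cases "pool \<Gamma> < 1")
      case True
      have "\<kappa> j \<in> {0, 1}"
        and "(\<Sum>i\<in>avail_in \<Gamma> c j. \<sigma> i) \<le> (real (card (avail_in \<Gamma> c j)) - 1) * \<kappa> j + 1"
        and le: "y j \<le> pool \<Gamma> * (\<Sum>i\<in>avail_in \<Gamma> c j. cap \<Gamma> i j * \<sigma> i) + bigM \<Gamma> c j * (1 - \<kappa> j)"
        using mip jc True unfolding mip_feasible_def by blast+
      \<comment> \<open>With \<open>\<kappa> j = 0\<close> the linking constraint would allow at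
        most one selected player; hence \<open>\<kappa> j = 1\<close> and the big-M term
        vanishes.\<close>
      moreover have "(\<Sum>i\<in>avail_in \<Gamma> c j. \<sigma> i) \<ge> 2"
        using j sum_\<sigma>[of "\<lambda>_. 1" j] by (simp add: R_com_def)
      ultimately have "\<kappa> j = 1" by auto
      then show ?thesis using le by (simp add: sum_\<sigma>)
    next
      \<comment> \<open>For pooling parameter 1, the plain capacity bound on \<open>y\<close>
        already is the pooling bound.\<close>
      case False
      then have "pool \<Gamma> = 1" using pool_le_1 by simp
      moreover have "y j \<le> (\<Sum>i\<in>avail_in \<Gamma> c j. cap \<Gamma> i j * \<sigma> i)"
        using mip jc unfolding mip_feasible_def by blast
      ultimately show ?thesis by (simp add: sum_\<sigma>)
    qed
  qed
  have ind: "x i j \<in> \<nat>" if j: "j \<in> R_ind \<Gamma> s" and i: "i \<in> avail_in \<Gamma> s j" for i j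
  \<comment> \<open>If the item is common in \<open>c\<close>, the MIP only makes \<open>y j\<close>
    integral, but \<open>y j\<close> is the plan of the single remaining player. Otherwise the item
    is individual in \<open>c\<close> as well.\<close>
  proof (cases "j \<in> R_com \<Gamma> c")
    case True
    have "avail_in \<Gamma> s j = {i}"
      using j i by (auto simp: R_ind_def card_Suc_eq)
    then have "y j = x i j"
      using yc[OF True] sum_x[OF R_ind_in_items[OF j]] by simp
    moreover have "y j \<in> \<nat>"
      using mip True unfolding mip_feasible_def by blast
    ultimately show ?thesis by simp
  next
    case False
    have "card (avail_in \<Gamma> c j) \<noteq> 0"
      using fina[of j] avs[of \<Gamma> j] i by auto
    then have "j \<in> R_ind \<Gamma> c"
      using False R_ind_in_items[OF j] i avs[of \<Gamma> j] by (auto simp: R_ind_def R_com_def R_all_def)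
    moreover have "i \<in> c" "j \<in> items_of \<Gamma> i"
      using mem_items_of[OF R_ind_in_items[OF j] i] sc by auto
    ultimately show ?thesis using mip unfolding mip_feasible_def by blast
  qed
  have priv: "priv_ok \<Gamma> i (x i)" if "i \<in> s" for i
    using mip that sc \<sigma>[of i] by (force simp: mip_feasible_def priv_ok_def)
  have caps: "0 \<le> x i j \<and> x i j \<le> cap \<Gamma> i j" if "i \<in> s" "j \<in> items_of \<Gamma> i" for i j
    using box[of i j] that sc \<sigma>[of i] by auto
  show "coal_feasible \<Gamma> s x y"
    unfolding coal_feasible_def using budget ys priv caps pool ind by auto
  have "(\<Sum>i\<in>c. \<Sum>j\<in>items_of \<Gamma> i. profit \<Gamma> i j * x i j)
      = (\<Sum>i\<in>s. \<Sum>j\<in>items_of \<Gamma> i. profit \<Gamma> i j * x i j)"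
    using finc sc by (intro sum.mono_neutral_right) (auto simp: x0)
  then show "mip_objective \<Gamma> vbar c \<sigma> x = coal_objective \<Gamma> s x - (\<Sum>i\<in>s. vbar i)"
    by (simp add: mip_objective_def sum_\<sigma>c coal_objective_players[OF finite_items fins])
qed

section \<open>From the coalition program to the separation MIP\<close>

text \<open>The pooled amounts are recomputed from \<open>x\<close> because the given
  \<open>y\<close> is arbitrary at items that are common in \<open>c\<close> but not in
  \<open>s\<close>. The choice of \<open>\<kappa>\<close> records whether at least two players of
  \<open>s\<close> share the item.\<close>

lemma coal_feasible_imp_mip_feasible:
  assumes c: "c \<subseteq> players \<Gamma>" and sc: "s \<subseteq> c" and coal: "coal_feasible \<Gamma> s x y"
  shows "mip_feasible \<Gamma> c (\<lambda>i. if i \<in> s then 1 else 0) (restrict_plan \<Gamma> s x)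
    (\<lambda>j. \<Sum>i\<in>avail_in \<Gamma> s j. x i j)
    (\<lambda>j. if 2 \<le> card (avail_in \<Gamma> s j) then 1 else 0)"
    (is "mip_feasible \<Gamma> c ?\<sigma> ?x ?y ?\<kappa>")
proof -
  have finc: "finite c" using c finite_players finite_subset by blast
  then have fins: "finite s" using sc finite_subset by blast
  have fina: "finite (avail_in \<Gamma> c j)" "finite (avail_in \<Gamma> s j)" for j
    using finc fins by (simp_all add: avail_in_def)
  note avs = avail_in_mono[OF sc]
  have sum_x: "(\<Sum>i\<in>avail_in \<Gamma> c j. ?x i j) = ?y j" if "j \<in> items \<Gamma>" for j
    using that sc finc by (rule sum_avail_in_restrict_plan)
  have sum_\<sigma>: "(\<Sum>i\<in>avail_in \<Gamma> c j. h i * ?\<sigma> i) = (\<Sum>i\<in>avail_in \<Gamma> s j. h i)" for h :: "'i \<Rightarrow> real" and j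
    using fina avs sc by (intro sum.mono_neutral_cong_right) (auto simp: avail_in_def)
  have sum_\<sigma>c: "(\<Sum>i\<in>c. h i * ?\<sigma> i) = (\<Sum>i\<in>s. h i)" for h :: "'i \<Rightarrow> real"
    using finc sc by (intro sum.mono_neutral_cong_right) auto
  have card_\<sigma>: "(\<Sum>i\<in>avail_in \<Gamma> c j. ?\<sigma> i) = real (card (avail_in \<Gamma> s j))" for j
    using sum_\<sigma>[of "\<lambda>_. 1" j] by simp
  have caps: "0 \<le> x i j" "x i j \<le> cap \<Gamma> i j" if "i \<in> s" "j \<in> items_of \<Gamma> i" for i j
    using coal that by (auto simp: coal_feasible_def)
  have y_le: "?y j \<le> (\<Sum>i\<in>avail_in \<Gamma> s j. cap \<Gamma> i j)" if "j \<in> items \<Gamma>" for j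
    using that by (intro sum_mono) (auto intro!: caps dest: mem_items_of)
  have ys: "y j = ?y j" if "j \<in> R_com \<Gamma> s" for j
    using coal that by (simp add: coal_feasible_def)
  have com: "?y j \<in> \<nat>" "?y j \<le> pool \<Gamma> * (\<Sum>i\<in>avail_in \<Gamma> s j. cap \<Gamma> i j)" if "j \<in> R_com \<Gamma> s" for j
    using coal that unfolding ys[OF that, symmetric] coal_feasible_def by blast+
  have "(\<Sum>j\<in>R_ind \<Gamma> c. \<Sum>i\<in>avail_in \<Gamma> c j. weight \<Gamma> j * ?x i j) + (\<Sum>j\<in>R_com \<Gamma> c. weight \<Gamma> j * ?y j)
      = (\<Sum>j\<in>R_com \<Gamma> s. weight \<Gamma> j * y j)
      + (\<Sum>j\<in>R_ind \<Gamma> s. \<Sum>i\<in>avail_in \<Gamma> s j. weight \<Gamma> j * x i j)"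
    using load_eq[OF finite_items fins, of y x] load_eq[OF finite_items finc, of ?y ?x] ys
    by (simp add: sum_x R_com_in_items)
  also have "\<dots> \<le> (\<Sum>i\<in>c. budget \<Gamma> i * ?\<sigma> i)"
    unfolding sum_\<sigma>c using coal unfolding coal_feasible_def by blast
  finally have budget: "(\<Sum>j\<in>R_ind \<Gamma> c. \<Sum>i\<in>avail_in \<Gamma> c j. weight \<Gamma> j * ?x i j)
      + (\<Sum>j\<in>R_com \<Gamma> c. weight \<Gamma> j * ?y j) \<le> (\<Sum>i\<in>c. budget \<Gamma> i * ?\<sigma> i)" .
  have priv: "priv_lhs \<Gamma> i (?x i) k \<le> priv_rhs \<Gamma> i k * ?\<sigma> i" if "k < priv_rows \<Gamma> i" for i k
  proof (cases "i \<in> s")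
    case True
    then have "priv_lhs \<Gamma> i (?x i) = priv_lhs \<Gamma> i (x i)"
      by (intro priv_lhs_cong) (simp add: restrict_plan_def)
    then show ?thesis
      using coal True that by (simp add: coal_feasible_def priv_ok_def)
  next
    case False
    then have "priv_lhs \<Gamma> i (?x i) k = 0"
      by (intro priv_lhs_zero) (simp add: restrict_plan_def)
    then show ?thesis using False by simp
  qed
  have single: "x i j \<in> \<nat>" if "j \<in> items \<Gamma>" "avail_in \<Gamma> s j = {i}" for i j
    using coal that by (auto simp: coal_feasible_def R_ind_def R_all_def)
  \<comment> \<open>For an item not common in \<open>s\<close>, the pooled amount is 0 or one entry
    of an individual item, hence integral.\<close>
  have y_nat: "?y j \<in> \<nat>" if j: "j \<in> items \<Gamma>" for j
  proof (cases "j \<in> R_com \<Gamma> s")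
    case True
    then show ?thesis by (rule com)
  next
    case False
    have "card (avail_in \<Gamma> s j) < 2"
      using False j by (force simp: R_com_def R_all_def)
    then consider "avail_in \<Gamma> s j = {}" | i where "avail_in \<Gamma> s j = {i}"
      using fina(2)[of j] by (auto simp: less_2_cases_iff card_Suc_eq)
    then show ?thesis using single[OF j] by cases auto
  qed
  have ind: "?x i j \<in> \<nat>" if i: "i \<in> c" and j: "j \<in> R_ind \<Gamma> c" "j \<in> items_of \<Gamma> i" for i j
  proof (cases "i \<in> s")
    case True
    have "i \<in> avail_in \<Gamma> s j" using True j(2) by (simp add: items_of_def avail_in_def)
    moreover obtain k where "avail_in \<Gamma> c j = {k}"
      using j(1) by (auto simp: R_ind_def card_Suc_eq)
    ultimately have "avail_in \<Gamma> s j = {i}"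
      using avs[of \<Gamma> j] by auto
    then show ?thesis
      using single[OF R_ind_in_items[OF j(1)]] by (simp add: restrict_plan_def)
  qed (simp add: restrict_plan_def)
  have pool: "2 * ?\<kappa> j \<le> (\<Sum>i\<in>avail_in \<Gamma> c j. ?\<sigma> i)
      \<and> (\<Sum>i\<in>avail_in \<Gamma> c j. ?\<sigma> i) \<le> (real (card (avail_in \<Gamma> c j)) - 1) * ?\<kappa> j + 1
      \<and> ?y j \<le> pool \<Gamma> * (\<Sum>i\<in>avail_in \<Gamma> c j. cap \<Gamma> i j * ?\<sigma> i) + bigM \<Gamma> c j * (1 - ?\<kappa> j)"
    if j: "j \<in> R_com \<Gamma> c" for j
  proof (cases "2 \<le> card (avail_in \<Gamma> s j)")
    case True
    then have "j \<in> R_com \<Gamma> s"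
      using R_com_in_items[OF j] by (auto simp: R_com_def R_all_def)
    then have "?y j \<le> pool \<Gamma> * (\<Sum>i\<in>avail_in \<Gamma> s j. cap \<Gamma> i j)"
      by (rule com)
    \<comment> \<open>With \<open>?\<kappa> j = 1\<close> the upper linking constraint reduces to
      this comparison of cardinalities.\<close>
    moreover have "card (avail_in \<Gamma> s j) \<le> card (avail_in \<Gamma> c j)"
      by (intro card_mono fina avs)
    ultimately show ?thesis
      unfolding card_\<sigma> sum_\<sigma> using True by simp
  next
    case False
    \<comment> \<open>Here \<open>?\<kappa> j = 0\<close>. Since capacities are nonnegative,
      \<open>bigM\<close> dominates the capacity sum over \<open>s\<close>, which bounds
      \<open>?y j\<close>, and the added pooling term is nonnegative.\<close>
    have cap0: "0 \<le> cap \<Gamma> i j" if "i \<in> avail_in \<Gamma> c j" for i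
      using that R_com_in_items[OF j] by (auto simp: avail_in_def intro: cap_nonneg)
    have "(\<Sum>i\<in>avail_in \<Gamma> s j. cap \<Gamma> i j) \<le> bigM \<Gamma> c j"
      unfolding bigM_def using cap0 by (intro sum_mono2 fina avs) auto
    moreover have "0 \<le> pool \<Gamma> * (\<Sum>i\<in>avail_in \<Gamma> s j. cap \<Gamma> i j)"
      using pool_pos cap0 avs[of \<Gamma> j] by (intro mult_nonneg_nonneg sum_nonneg) auto
    ultimately show ?thesis
      unfolding card_\<sigma> sum_\<sigma> using False y_le[OF R_com_in_items[OF j]] by simp
  qed
  have box: "0 \<le> ?x i j \<and> ?x i j \<le> cap \<Gamma> i j * ?\<sigma> i" if "j \<in> items_of \<Gamma> i" for i j
    using caps that by (simp add: restrict_plan_def)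
  have binary: "(if P then 1 else 0) \<in> {0, 1 :: real}" for P
    by simp
  show ?thesis
    unfolding mip_feasible_def
  proof (intro conjI ballI allI impI)
    fix j assume "j \<in> R_com \<Gamma> c"
    then have j: "j \<in> items \<Gamma>" by (rule R_com_in_items)
    show "?y j = (\<Sum>i\<in>avail_in \<Gamma> c j. ?x i j)" by (rule sum_x[OF j, symmetric])
    show "?y j \<le> (\<Sum>i\<in>avail_in \<Gamma> c j. cap \<Gamma> i j * ?\<sigma> i)" unfolding sum_\<sigma> by (rule y_le[OF j])
    show "?y j \<in> \<nat>" by (rule y_nat[OF j])
  qed (use binary budget priv box pool ind in blast)+
qed

section \<open>MIP objectives against separation gains\<close>

text \<open>Only an inequality, because \<open>x\<close> may be suboptimal for the coalition that
  \<open>\<sigma>\<close> selects.\<close>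

lemma mip_objective_le_sep_gain:
  assumes "c \<subseteq> players \<Gamma>" and "mip_feasible \<Gamma> c \<sigma> x y \<kappa>"
  shows "mip_objective \<Gamma> vbar c \<sigma> x \<le> sep_gain \<Gamma> vbar {i \<in> c. \<sigma> i = 1}"
  unfolding sep_gain_def mip_feasible_imp_coal_feasible(2)[OF assms]
  by (rule diff_right_mono, rule V_attained(2)[OF _ mip_feasible_imp_coal_feasible(1)[OF assms]])
    (use assms(1) in blast)

lemma sep_gain_attained_by_mip:
  assumes c: "c \<subseteq> players \<Gamma>" and sc: "s \<subseteq> c"
  shows "\<exists>\<sigma> x y \<kappa>. mip_feasible \<Gamma> c \<sigma> x y \<kappa> \<and> mip_objective \<Gamma> vbar c \<sigma> x = sep_gain \<Gamma> vbar s"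
proof -
  obtain x y where x: "coal_feasible \<Gamma> s x y" "coal_objective \<Gamma> s x = V \<Gamma> s"
    using V_attained(1) c sc by (meson subset_trans)
  note mip = coal_feasible_imp_mip_feasible[OF c sc x(1)]
  \<comment> \<open>The indicator selects exactly \<open>s\<close>, so the objective identity for
    MIP-feasible points applies to the witness directly.\<close>
  have s: "{i \<in> c. (if i \<in> s then 1 else 0) = (1::real)} = s" using sc by auto
  have "mip_objective \<Gamma> vbar c (\<lambda>i. if i \<in> s then 1 else 0) (restrict_plan \<Gamma> s x) = sep_gain \<Gamma> vbar s"
    using mip_feasible_imp_coal_feasible(2)[OF c mip, of vbar] x(2)
    unfolding s coal_objective_restrict_plan sep_gain_def by simp
  with mip show ?thesis by blast
qed

end

section \<open>Optimal values, maximizers and the stability criterion\<close>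

theorem proposition7:
  fixes \<Gamma> :: "('i, 'r) game"
    and vbar :: "'i \<Rightarrow> real"
    and zbar :: "'i \<Rightarrow> 'i \<Rightarrow> nat"
    and g :: 'i
    and c :: "'i set"
  assumes game: "pooling_game \<Gamma>"
    and zbar: "\<forall>i\<in>players \<Gamma>. \<forall>h\<in>players \<Gamma>. zbar i h \<in> {0, 1}"
    and g: "g \<in> players \<Gamma>"
    and c: "c = {i \<in> players \<Gamma>. zbar i g = 1}"
  shows "(\<exists>\<sigma> x y \<kappa>. mip_optimal \<Gamma> vbar c \<sigma> x y \<kappa>)
    \<and> mip_value \<Gamma> vbar c = sep_value \<Gamma> vbar c
    \<and> (\<forall>\<sigma> x y \<kappa>. mip_optimal \<Gamma> vbar c \<sigma> x y \<kappa> \<longrightarrow>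
         is_arg_max (sep_gain \<Gamma> vbar) (\<lambda>s. s \<subseteq> c) {i \<in> c. \<sigma> i = 1})
    \<and> (mip_value \<Gamma> vbar c \<le> 0 \<longleftrightarrow> (\<forall>s\<subseteq>c. (\<Sum>i\<in>s. vbar i) \<ge> V \<Gamma> s))"
proof -
  interpret pooling_game \<Gamma> by (rule game)
  have cN: "c \<subseteq> players \<Gamma>" using c by auto
  then have fin: "finite (sep_gain \<Gamma> vbar ` Pow c)"
    using finite_players finite_subset by blast
  have ub: "sep_gain \<Gamma> vbar s \<le> sep_value \<Gamma> vbar c" if "s \<subseteq> c" for s
    unfolding sep_value_def using fin that by (intro Max_ge) auto
  have "sep_value \<Gamma> vbar c \<in> sep_gain \<Gamma> vbar ` Pow c"
    unfolding sep_value_def using fin by (intro Max_in) auto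
  \<comment> \<open>A best subset of \<open>c\<close> is lifted to a MIP point whose objective meets
    the upper bound \<open>sep_value\<close>; this settles both the existence of an optimum and its
    value.\<close>
  then obtain \<sigma>0 x0 y0 \<kappa>0 where mip0: "mip_feasible \<Gamma> c \<sigma>0 x0 y0 \<kappa>0"
    and obj0: "mip_objective \<Gamma> vbar c \<sigma>0 x0 = sep_value \<Gamma> vbar c"
    using sep_gain_attained_by_mip[OF cN] by (metis PowD imageE)
  have le_gain: "mip_objective \<Gamma> vbar c \<sigma> x \<le> sep_gain \<Gamma> vbar {i \<in> c. \<sigma> i = 1}"
    and le: "mip_objective \<Gamma> vbar c \<sigma> x \<le> sep_value \<Gamma> vbar c"
    if "mip_feasible \<Gamma> c \<sigma> x y \<kappa>" for \<sigma> x y \<kappa>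
    using mip_objective_le_sep_gain[OF cN that, of vbar] ub[of "{i \<in> c. \<sigma> i = 1}"] by auto
  have opt0: "mip_optimal \<Gamma> vbar c \<sigma>0 x0 y0 \<kappa>0"
    unfolding mip_optimal_def is_arg_max_linorder_iff using mip0 obj0 le by auto
  have val: "mip_value \<Gamma> vbar c = sep_value \<Gamma> vbar c"
    unfolding mip_value_def using mip0 obj0 le by (intro Greatest_equality) (metis, auto)
  have arg: "is_arg_max (sep_gain \<Gamma> vbar) (\<lambda>s. s \<subseteq> c) {i \<in> c. \<sigma> i = 1}"
    if "mip_optimal \<Gamma> vbar c \<sigma> x y \<kappa>" for \<sigma> x y \<kappa>
  proof -
    \<comment> \<open>An optimal point is at least as good as the lifted one, while its objective is
      at most the gain of the set it selects. That set therefore reaches the maximal gain.\<close>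
    have feas: "mip_feasible \<Gamma> c \<sigma> x y \<kappa>"
      and "sep_value \<Gamma> vbar c \<le> mip_objective \<Gamma> vbar c \<sigma> x"
      using that mip0 obj0 unfolding mip_optimal_def is_arg_max_linorder_iff by force+
    then have "sep_value \<Gamma> vbar c \<le> sep_gain \<Gamma> vbar {i \<in> c. \<sigma> i = 1}"
      using le_gain[OF feas] by simp
    then show ?thesis
      unfolding is_arg_max_linorder_iff by (auto intro: order_trans[OF ub])
  qed
  have "sep_value \<Gamma> vbar c \<le> 0 \<longleftrightarrow> (\<forall>s\<subseteq>c. sep_gain \<Gamma> vbar s \<le> 0)"
    unfolding sep_value_def using fin by (subst Max_le_iff) auto
  then have "mip_value \<Gamma> vbar c \<le> 0 \<longleftrightarrow> (\<forall>s\<subseteq>c. (\<Sum>i\<in>s. vbar i) \<ge> V \<Gamma> s)"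
    by (simp add: val sep_gain_def)
  then show ?thesis
    using opt0 val arg by blast
qed

end
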